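(* For every integer $n\ge 1$, the number $$R_n=2^{\binom{n-1}{2}}\,(2n)!\;F(2^{-n})\prod_{m=1}^{\lfloor n/2\rfloor}(2^{2m}-1)$$ is odd. Equivalently, for every $n\ge1$, $$\nu_2\bigl(\operatorname{up}(1-2^{-n})\bigr)=-\binom{n}{2}-1-\nu_2(n!).$$
   Context: The Rvachev function $\operatorname{up}:\mathbb{R}\to\mathbb{R}$ is the infinitely differentiable function with compact support $[-1,1]$ satisfying $\operatorname{up}(0)=1$ and $\operatorname{up}'(x)=2\bigl(\operatorname{up}(2x+1)-\operatorname{up}(2x-1)\bigr)$ for all $x\in\mathbb{R}$; equivalently $\operatorname{up}(x)=\int_{\mathbb{R}}\widehat{\operatorname{up}}(t)e^{2\pi i t x}\,dt$ with $\widehat{\operatorname{up}}(z)=\prod_{n=0}^\infty \frac{\sin(\pi z/2^n)}{\pi z/2^n}$. The Fabius function is $F(x)=\sum_{n=0}^\infty(-1)^{w(n)}\operatorname{up}(x-2n-1)$ for $x\in\mathbb{R}$, where $w(n)$ is the sum of the binary digits of $n$; in particular $F(2^{-n})=\operatorname{up}(1-2^{-n})$ for $n\ge0$. The values of $\operatorname{up}$ at dyadic points are rational numbers, and the $R_n$ ($n\ge1$) are natural numbers. For a nonzero rational number $r$, $\nu_2(r)$ denotes its dyadic valuation, i.e. the exponent of $2$ in the prime factorization of $r$. Empty products equal $1$. *)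

theory Defs
  imports "HOL-Analysis.Analysis"
begin

definition smooth :: "(real \<Rightarrow> real) \<Rightarrow> bool" where
  "smooth f \<longleftrightarrow> (\<forall>k x. (deriv ^^ k) f field_differentiable (at x))"

definition is_rvachev_up :: "(real \<Rightarrow> real) \<Rightarrow> bool" where
  "is_rvachev_up f \<longleftrightarrow>
     smooth f \<and> closure {x. f x \<noteq> 0} = {-1..1} \<and> f 0 = 1 \<and>
     (\<forall>x. deriv f x = 2 * (f (2 * x + 1) - f (2 * x - 1)))"

(* Integrating the equation shows that a solution is a fixed point of
   f |-> (\<lambda>x. integral {2*x-1..2*x+1} f) with integral 1. The square of this map
   is a contraction for the sup norm on the continuous functions that vanish outside
   [-1,1] and have integral 1, so exactly one function satisfies is_rvachev_up. *)
definition rvachev_up :: "real \<Rightarrow> real" where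
  "rvachev_up = (THE f. is_rvachev_up f)"

(* The digits in positions k \<ge> n vanish because n < 2^n. *)
definition binary_digit_sum :: "nat \<Rightarrow> nat" where
  "binary_digit_sum n = (\<Sum>k<n. n div 2 ^ k mod 2)"

(* For each x at most one term of the series is nonzero. *)
definition fabius :: "real \<Rightarrow> real" where
  "fabius x = (\<Sum>n. (-1) ^ binary_digit_sum n * rvachev_up (x - 2 * real n - 1))"

definition fabius_R :: "nat \<Rightarrow> real" where
  "fabius_R n = 2 ^ ((n - 1) choose 2) * fact (2 * n) * fabius (1 / 2 ^ n)
                  * (\<Prod>m = 1..n div 2. (2 ^ (2 * m) - 1))"

(* quotient_of returns the fraction in lowest terms. The value at 0 carries no meaning. *)
definition dyadic_valuation :: "rat \<Rightarrow> int" where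
  "dyadic_valuation r =
     int (multiplicity 2 (fst (quotient_of r))) - int (multiplicity 2 (snd (quotient_of r)))"

end

(* A solution of the functional equation is a fixed point of f |-> (x |-> integral of f over
   [2x-1, 2x+1]) with f x + f (x-1) = 1 on [0,1]; the square of this map contracts the sup norm,
   which gives existence and uniqueness.
   Write E P for the integral of P * up and put d_n = E ((1+t)/2)^n. Integration by parts gives
   up (1 - 2^(-n)) = d_n / (2^(n choose 2) n!), so everything reduces to 2 d_n being a quotient of
   odd integers. The moments of t satisfy a recurrence that bounds the denominators but hides the
   2-adic size. Instead use w_j = E z^j with z = (1-t^2)/4: since (1+t)/2 and (1-t)/2 have sum 1
   and product z, 2 d_n is an integral combination of the w_j with constant term 1, while
   (2i+1) E t^(2i) = 2 d_(2i+1) turns the expansion of 4^j w_j = E (1-t^2)^j into a recurrence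
   expressing (4^j - 1) w_j through w_0, ..., w_(j-1). By induction every w_j with j >= 1 is
   twice a fraction with odd denominator. *)

theory Submission
  imports Defs
begin

section \<open>Existence and uniqueness of the Rvachev function\<close>

text \<open>Global antiderivatives replace integrals below: an integral over a moving interval
  becomes a difference of values, and affine substitutions become the chain rule.\<close>

lemma ex_antiderivative:
  fixes f :: "real \<Rightarrow> real"
  assumes "continuous_on UNIV f"
  obtains \<Phi> where "\<And>x. (\<Phi> has_real_derivative f x) (at x)"
proof -
  have "\<exists>F. \<forall>x::real. - \<infinity> < ereal x \<longrightarrow> ereal x < \<infinity> \<longrightarrow> (F has_vector_derivative f x) (at x)"
    by (rule einterval_antiderivative) (use assms in \<open>auto simp: continuous_on_eq_continuous_at\<close>)
  then show ?thesis
    using that by (auto simp: has_real_derivative_iff_has_vector_derivative)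
qed

lemma integral_antiderivative:
  fixes f :: "real \<Rightarrow> real"
  assumes "a \<le> b" "\<And>x. x \<in> {a..b} \<Longrightarrow> (\<Phi> has_real_derivative f x) (at x)"
  shows "integral {a..b} f = \<Phi> b - \<Phi> a"
  using fundamental_theorem_of_calculus[of a b \<Phi> f] assms
  by (metis has_field_derivative_at_within has_real_derivative_iff_has_vector_derivative
      integral_unique)

text \<open>Both \<open>Q - \<Phi>\<close> and \<open>Q + \<Phi>\<close> have nonnegative derivative
  on the interval.\<close>

lemma abs_diff_le_of_abs_deriv_le:
  fixes \<Phi> :: "real \<Rightarrow> real"
  assumes "a \<le> b"
    and "\<And>x. x \<in> {a..b} \<Longrightarrow> (\<Phi> has_real_derivative f x) (at x)"
    and "\<And>x. x \<in> {a..b} \<Longrightarrow> (Q has_real_derivative q x) (at x)"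
    and "\<And>x. x \<in> {a..b} \<Longrightarrow> \<bar>f x\<bar> \<le> q x"
  shows "\<bar>\<Phi> b - \<Phi> a\<bar> \<le> Q b - Q a"
proof -
  have "Q a - \<Phi> a \<le> Q b - \<Phi> b"
  proof (rule DERIV_nonneg_imp_nondecreasing[OF assms(1)])
    fix x assume "a \<le> x" "x \<le> b"
    then show "\<exists>y. ((\<lambda>x. Q x - \<Phi> x) has_real_derivative y) (at x) \<and> 0 \<le> y"
      using assms(2,3,4)[of x] by (intro exI[of _ "q x - f x"]) (auto intro!: DERIV_diff)
  qed
  moreover have "Q a + \<Phi> a \<le> Q b + \<Phi> b"
  proof (rule DERIV_nonneg_imp_nondecreasing[OF assms(1)])
    fix x assume "a \<le> x" "x \<le> b"
    then show "\<exists>y. ((\<lambda>x. Q x + \<Phi> x) has_real_derivative y) (at x) \<and> 0 \<le> y"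
      using assms(2,3,4)[of x] by (intro exI[of _ "q x + f x"]) (auto intro!: DERIV_add)
  qed
  ultimately show ?thesis by linarith
qed

lemma const_of_deriv_eq_0:
  fixes \<Phi> :: "real \<Rightarrow> real"
  assumes "\<And>x. x \<in> {min a b..max a b} \<Longrightarrow> (\<Phi> has_real_derivative 0) (at x)"
  shows "\<Phi> a = \<Phi> b"
proof -
  have "\<bar>\<Phi> (max a b) - \<Phi> (min a b)\<bar> \<le> 0 - 0"
    by (rule abs_diff_le_of_abs_deriv_le[where f = "\<lambda>_. 0" and Q = "\<lambda>_. 0" and q = "\<lambda>_. 0"])
      (use assms in auto)
  then show ?thesis by (auto simp: max_def min_def split: if_splits)
qed

lemma continuous_of_derivative:
  fixes \<Phi> :: "real \<Rightarrow> real"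
  assumes "\<And>x. (\<Phi> has_real_derivative f x) (at x)"
  shows "continuous_on A \<Phi>"
  by (meson assms DERIV_isCont continuous_at_imp_continuous_on)

section \<open>The averaging operator and the contraction estimate\<close>

definition avg :: "(real \<Rightarrow> real) \<Rightarrow> real \<Rightarrow> real" where
  "avg f x = integral {2 * x - 1..2 * x + 1} f"

text \<open>The last condition is a pointwise substitute for having integral \<open>c\<close>:
  integrating it over [0,1] gives that integral, and at \<open>x = 0\<close> it gives
  \<open>f 0 = c\<close>. It also relates the two halves of the support, which the contraction
  estimate needs.\<close>

definition admissible :: "real \<Rightarrow> (real \<Rightarrow> real) \<Rightarrow> bool" where
  "admissible c f \<longleftrightarrow> continuous_on UNIV f \<and> (\<forall>x. \<bar>x\<bar> \<ge> 1 \<longrightarrow> f x = 0) \<and>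
     (\<forall>x\<in>{0..1}. f x + f (x - 1) = c)"

lemma admissible_diff:
  "admissible a f \<Longrightarrow> admissible b g \<Longrightarrow> admissible (a - b) (\<lambda>x. f x - g x)"
  unfolding admissible_def by (fastforce intro!: continuous_intros simp: algebra_simps)

lemma avg_eq:
  assumes "\<And>x. (\<Phi> has_real_derivative f x) (at x)"
  shows "avg f x = \<Phi> (2 * x + 1) - \<Phi> (2 * x - 1)"
  unfolding avg_def by (rule integral_antiderivative) (use assms in auto)

lemma has_derivative_avg:
  assumes "continuous_on UNIV f"
  shows "(avg f has_real_derivative 2 * (f (2 * x + 1) - f (2 * x - 1))) (at x)"
proof -
  obtain \<Phi> where \<Phi>: "\<And>x. (\<Phi> has_real_derivative f x) (at x)"
    using ex_antiderivative[OF assms] by blast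
  have "avg f = (\<lambda>x. \<Phi> (2 * x + 1) - \<Phi> (2 * x - 1))"
    using avg_eq[OF \<Phi>] by auto
  then show ?thesis
    by (auto intro!: derivative_eq_intros DERIV_chain2[OF \<Phi>])
qed

lemma avg_diff:
  assumes "continuous_on UNIV f" "continuous_on UNIV g"
  shows "avg (\<lambda>x. f x - g x) = (\<lambda>x. avg f x - avg g x)"
  unfolding avg_def
  by (intro ext Henstock_Kurzweil_Integration.integral_diff integrable_continuous_real)
    (use assms continuous_on_subset in blast)+

context
  fixes c f \<Phi>
  assumes f: "admissible c f" and \<Phi>: "\<And>x. (\<Phi> has_real_derivative f x) (at x)"
begin

lemma antiderivative_right: "x \<ge> 1 \<Longrightarrow> \<Phi> x = \<Phi> 1"
  and antiderivative_left: "x \<le> -1 \<Longrightarrow> \<Phi> x = \<Phi> (-1)"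
proof -
  have "(\<Phi> has_real_derivative 0) (at x)" if "\<bar>x\<bar> \<ge> 1" for x
    using \<Phi>[of x] f that by (auto simp: admissible_def)
  then show "x \<ge> 1 \<Longrightarrow> \<Phi> x = \<Phi> 1" "x \<le> -1 \<Longrightarrow> \<Phi> x = \<Phi> (-1)"
    by (auto intro!: const_of_deriv_eq_0[where \<Phi> = \<Phi>])
qed

lemma antiderivative_shift:
  assumes "x \<in> {0..1}"
  shows "\<Phi> x + \<Phi> (x - 1) = c * x + \<Phi> 0 + \<Phi> (-1)"
proof -
  let ?\<Psi> = "\<lambda>x. \<Phi> x + \<Phi> (x - 1) - c * x"
  have "?\<Psi> x = ?\<Psi> 0"
  proof (rule const_of_deriv_eq_0[where \<Phi> = ?\<Psi>])
    fix y assume "y \<in> {min x 0..max x 0}"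
    then have "y \<in> {0..1}" using assms by auto
    then have "f y + f (y - 1) - c = 0" using f by (auto simp: admissible_def)
    then show "(?\<Psi> has_real_derivative 0) (at y)"
      by (auto intro!: derivative_eq_intros DERIV_chain2[OF \<Phi>])
  qed
  then show ?thesis by simp
qed

lemma antiderivative_total: "\<Phi> 1 - \<Phi> (-1) = c"
  using antiderivative_shift[of 1] by simp

end

text \<open>\<open>avg f x + avg f (x - 1)\<close> telescopes to
  \<open>\<Phi> (2 * x + 1) - \<Phi> (2 * x - 3)\<close>. For \<open>x\<close> in [0,1] these
  arguments lie beyond the two ends of the support, so the difference is the total integral
  \<open>c\<close>.\<close>

lemma admissible_avg:
  assumes "admissible c f"
  shows "admissible c (avg f)"
proof -
  have cont: "continuous_on UNIV f" using assms by (simp add: admissible_def)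
  then obtain \<Phi> where \<Phi>: "\<And>x. (\<Phi> has_real_derivative f x) (at x)"
    using ex_antiderivative by blast
  note r = antiderivative_right[OF assms \<Phi>] and l = antiderivative_left[OF assms \<Phi>]
  note eq = avg_eq[of \<Phi> f, OF \<Phi>]
  have "avg f x = 0" if "x \<ge> 1" for x
    using that r[of "2 * x + 1"] r[of "2 * x - 1"] by (simp add: eq)
  moreover have "avg f x = 0" if "x \<le> -1" for x
    using that l[of "2 * x + 1"] l[of "2 * x - 1"] by (simp add: eq)
  moreover have "avg f x + avg f (x - 1) = c" if "x \<in> {0..1}" for x
    using that r[of "2 * x + 1"] l[of "2 * x - 3"] antiderivative_total[OF assms \<Phi>]
    by (simp add: eq algebra_simps)
  ultimately show ?thesis
    unfolding admissible_def
    using continuous_of_derivative[OF has_derivative_avg[OF cont]] by (auto simp: abs_if split: if_splits)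
qed

text \<open>For \<open>x\<close> in [0,1] the average is the integral of \<open>h\<close> over
  [2x-1, 1]. If 2x-1 is negative, the shift relation with \<open>c = 0\<close> turns this into the
  integral over [0, 2x]. Either way only values on [0,1] enter, where \<open>q\<close> is a
  bound.\<close>

lemma abs_avg_le:
  assumes h: "admissible 0 h"
    and Q: "\<And>x. (Q has_real_derivative q x) (at x)"
    and q: "\<And>x. x \<in> {0..1} \<Longrightarrow> \<bar>h x\<bar> \<le> q x"
    and x: "x \<in> {0..1}"
  shows "\<bar>avg h x\<bar> \<le> (if x \<le> 1 / 2 then Q (2 * x) - Q 0 else Q 1 - Q (2 * x - 1))"
proof -
  have "continuous_on UNIV h" using h by (simp add: admissible_def)
  then obtain \<Phi> where \<Phi>: "\<And>x. (\<Phi> has_real_derivative h x) (at x)"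
    using ex_antiderivative by blast
  have eq: "avg h x = \<Phi> 1 - \<Phi> (2 * x - 1)"
    using x avg_eq[OF \<Phi>] antiderivative_right[OF h \<Phi>, of "2 * x + 1"] by simp
  show ?thesis
  proof (cases "x \<le> 1 / 2")
    case True
    then have "avg h x = \<Phi> (2 * x) - \<Phi> 0"
      using x antiderivative_shift[OF h \<Phi>, of "2 * x"] antiderivative_total[OF h \<Phi>] eq by simp
    moreover have "\<bar>\<Phi> (2 * x) - \<Phi> 0\<bar> \<le> Q (2 * x) - Q 0"
      by (rule abs_diff_le_of_abs_deriv_le[OF _ \<Phi> Q]) (use x q True in auto)
    ultimately show ?thesis using True by simp
  next
    case False
    moreover have "\<bar>\<Phi> 1 - \<Phi> (2 * x - 1)\<bar> \<le> Q 1 - Q (2 * x - 1)"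
      by (rule abs_diff_le_of_abs_deriv_le[OF _ \<Phi> Q]) (use x q False in auto)
    ultimately show ?thesis using eq by simp
  qed
qed

text \<open>One averaging gives only the tent bound with peak \<open>M\<close>, hence no
  contraction. The parabola 4x(1-x) dominates the tent and has integral 2/3 over [0,1], so the
  second averaging gains the factor 2/3.\<close>

lemma abs_avg_avg_le:
  assumes h: "admissible 0 h" and M: "\<And>x. \<bar>h x\<bar> \<le> M"
  shows "\<bar>avg (avg h) x\<bar> \<le> 2 / 3 * M"
proof -
  have M0: "M \<ge> 0" using M[of 0] by simp
  have 1: "\<bar>avg h x\<bar> \<le> 4 * M * (x * (1 - x))" if x: "x \<in> {0..1}" for x
  proof -
    have "\<bar>avg h x\<bar> \<le> (if x \<le> 1 / 2 then M * (2 * x) - M * 0 else M * 1 - M * (2 * x - 1))"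
      by (rule abs_avg_le[OF h, where q = "\<lambda>_. M"])
        (use M x in \<open>auto intro!: derivative_eq_intros\<close>)
    also have "\<dots> = M * (if x \<le> 1 / 2 then 2 * x else 2 - 2 * x)"
      by (simp add: algebra_simps)
    also have "\<dots> \<le> M * (4 * (x * (1 - x)))"
    proof (rule mult_left_mono[OF _ M0])
      have "0 \<le> 2 * x * (1 - 2 * x)" if "x \<le> 1 / 2" using x that by simp
      moreover have "0 \<le> 2 * (1 - x) * (2 * x - 1)" if "\<not> x \<le> 1 / 2" using x that by simp
      ultimately show "(if x \<le> 1 / 2 then 2 * x else 2 - 2 * x) \<le> 4 * (x * (1 - x))"
        by (auto simp: algebra_simps)
    qed
    finally show ?thesis by (simp add: mult.assoc mult.left_commute)
  qed
  let ?Q = "\<lambda>x::real. 4 * M * (x^2 / 2 - x^3 / 3)"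
  have h': "admissible 0 (avg h)" by (rule admissible_avg[OF h])
  have Q: "(?Q has_real_derivative 4 * M * (x * (1 - x))) (at x)" for x
    by (auto intro!: derivative_eq_intros simp: algebra_simps power2_eq_square)
  have mono: "0 \<le> ?Q x \<and> ?Q x \<le> ?Q 1" if "x \<in> {0..1}" for x
  proof -
    have "0 \<le> x^2 / 2 - x^3 / 3 \<and> x^2 / 2 - x^3 / 3 \<le> (1/6::real)"
    proof
      \<comment> \<open>Six times x^2/2 - x^3/3 equals x^2 (3 - 2x), and subtracting this from 1
        leaves (1 - x)^2 (1 + 2x).\<close>
      have "x^2 * (3 - 2 * x) \<ge> 0" using that by simp
      then show "0 \<le> x^2 / 2 - x^3 / 3" by (simp add: algebra_simps power2_eq_square power3_eq_cube)
      have "(1 - x)^2 * (1 + 2 * x) \<ge> 0" using that by simp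
      then show "x^2 / 2 - x^3 / 3 \<le> 1/6" by (simp add: algebra_simps power2_eq_square power3_eq_cube)
    qed
    then have "0 \<le> ?Q x" "?Q x \<le> 4 * M * (1 / 6)"
      using M0 by (simp, intro mult_left_mono) simp_all
    then show ?thesis by simp
  qed
  have 2: "\<bar>avg (avg h) x\<bar> \<le> 2 / 3 * M" if x: "x \<in> {0..1}" for x
  proof -
    have "\<bar>avg (avg h) x\<bar> \<le> (if x \<le> 1 / 2 then ?Q (2 * x) - ?Q 0 else ?Q 1 - ?Q (2 * x - 1))"
      by (rule abs_avg_le[OF h' Q 1 x])
    also have "\<dots> \<le> ?Q 1"
      using mono[of "2 * x"] mono[of "2 * x - 1"] x by auto
    finally show ?thesis by simp
  qed
  have a: "admissible 0 (avg (avg h))" by (rule admissible_avg[OF h'])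
  \<comment> \<open>With \<open>c = 0\<close> the shift relation is an antisymmetry, so the bound on
    [0,1] carries over to [-1,0].\<close>
  consider "\<bar>x\<bar> \<ge> 1" | "x \<in> {0..1}" | "x + 1 \<in> {0..1}" by fastforce
  then show ?thesis
  proof cases
    case 1
    then show ?thesis using a M0 by (simp add: admissible_def)
  next
    case 3
    then have "avg (avg h) x = - avg (avg h) (x + 1)"
      using a unfolding admissible_def by (metis add_diff_cancel_right' add_eq_0_iff)
    then show ?thesis using 2[OF 3] by simp
  qed (rule 2)
qed

lemma admissible_attains_sup:
  assumes "admissible c f"
  obtains x0 where "\<And>x. \<bar>f x\<bar> \<le> \<bar>f x0\<bar>"
proof -
  have "continuous_on {-1..1} (\<lambda>x. \<bar>f x\<bar>)"
    using assms by (auto simp: admissible_def intro!: continuous_intros elim: continuous_on_subset)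
  then obtain x0 where x0: "x0 \<in> {-1..1}" "\<And>x. x \<in> {-1..1} \<Longrightarrow> \<bar>f x\<bar> \<le> \<bar>f x0\<bar>"
    using continuous_attains_sup[of "{-1..1::real}" "\<lambda>x. \<bar>f x\<bar>"] by auto
  have "\<bar>f x\<bar> \<le> \<bar>f x0\<bar>" for x
  proof (cases "\<bar>x\<bar> \<ge> 1")
    case True
    then show ?thesis using assms by (simp add: admissible_def)
  qed (auto intro!: x0(2))
  then show ?thesis using that by blast
qed

lemma admissible_bcontfun:
  assumes "admissible c f"
  shows "f \<in> bcontfun"
  using admissible_attains_sup[OF assms] assms bcontfun_normI[of f]
  unfolding admissible_def real_norm_def by metis

text \<open>The difference is a fixed point with \<open>c = 0\<close>. At a point where its absolute
  value is largest, the contraction estimate forces it to vanish.\<close>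

lemma avg_fixed_point_unique:
  assumes f: "admissible c f" "avg f = f" and g: "admissible c g" "avg g = g"
  shows "f = g"
proof -
  let ?h = "\<lambda>x. f x - g x"
  have h: "admissible 0 ?h" using admissible_diff[OF f(1) g(1)] by simp
  have "avg ?h = ?h"
    using avg_diff f g by (auto simp: admissible_def)
  moreover obtain x0 where x0: "\<And>x. \<bar>?h x\<bar> \<le> \<bar>?h x0\<bar>"
    using admissible_attains_sup[OF h] by blast
  ultimately have "\<bar>?h x0\<bar> \<le> 2 / 3 * \<bar>?h x0\<bar>"
    using abs_avg_avg_le[OF h x0, of x0] by simp
  then have "\<bar>?h x0\<bar> = 0" by argo
  then have "?h x = 0" for x using x0[of x] by simp
  then show ?thesis by auto
qed

lemma avg_nonneg:
  assumes "continuous_on UNIV f" "\<And>x. f x \<ge> 0"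
  shows "avg f x \<ge> 0"
  unfolding avg_def by (rule Henstock_Kurzweil_Integration.integral_nonneg)
   (use assms in \<open>auto intro!: integrable_continuous_real elim: continuous_on_subset\<close>)

lemma apply_bcontfun_tendsto:
  fixes F :: "nat \<Rightarrow> real \<Rightarrow>\<^sub>C real"
  assumes "F \<longlonglongrightarrow> G"
  shows "(\<lambda>n. F n x) \<longlonglongrightarrow> G x"
  using tendsto_bcontfun_uniform_limit[OF assms] by (rule tendsto_uniform_limitI) simp

text \<open>Continuity is built into the type; the other conditions are pointwise and survive
  limits.\<close>

lemma closed_admissible_bcontfun:
  "closed {F :: real \<Rightarrow>\<^sub>C real. admissible c F \<and> (\<forall>x. F x \<ge> 0)}"
  unfolding closed_sequential_limits
proof (intro allI impI)
  fix F :: "nat \<Rightarrow> real \<Rightarrow>\<^sub>C real" and G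
  assume "(\<forall>n. F n \<in> {F :: real \<Rightarrow>\<^sub>C real. admissible c F \<and> (\<forall>x. F x \<ge> 0)}) \<and> F \<longlonglongrightarrow> G"
  then have F: "admissible c (F n)" "F n x \<ge> 0" and lim: "F \<longlonglongrightarrow> G" for n x by auto
  note t = apply_bcontfun_tendsto[OF lim]
  have "G x = 0" if "\<bar>x\<bar> \<ge> 1" for x
    using t[of x] F(1) that by (simp add: admissible_def LIMSEQ_const_iff)
  moreover have "G x + G (x - 1) = c" if "x \<in> {0..1}" for x
    using tendsto_add[OF t[of x] t[of "x - 1"]] F(1) that by (simp add: admissible_def LIMSEQ_const_iff)
  moreover have "G x \<ge> 0" for x
    using LIMSEQ_le_const[OF t[of x]] F(2) by blast
  ultimately show "G \<in> {F :: real \<Rightarrow>\<^sub>C real. admissible c F \<and> (\<forall>x. F x \<ge> 0)}"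
    by (auto simp: admissible_def)
qed

text \<open>Banach's theorem is applied to the square of \<open>avg\<close>. Nonnegativity is
  carried along because the support of the fixed point is later computed from it.\<close>

lemma ex_avg_fixed_point:
  obtains p where "admissible 1 p" "avg p = p" "\<And>x. p x \<ge> 0"
proof -
  let ?S = "{F :: real \<Rightarrow>\<^sub>C real. admissible 1 F \<and> (\<forall>x. F x \<ge> 0)}"
  let ?T = "\<lambda>F :: real \<Rightarrow>\<^sub>C real. Bcontfun (avg (avg F))"
  have cont: "continuous_on UNIV F" if "F \<in> ?S" for F :: "real \<Rightarrow>\<^sub>C real"
    using that by simp
  have avg2: "admissible 1 (avg (avg F))" if "F \<in> ?S" for F
    using that by (auto intro!: admissible_avg)
  have T: "apply_bcontfun (?T F) = avg (avg F)" if "F \<in> ?S" for F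
    using admissible_bcontfun[OF avg2[OF that]] by (simp add: Bcontfun_inverse)
  have cont_avg: "continuous_on UNIV (avg F)" if "F \<in> ?S" for F
    using that admissible_avg[of 1 F] by (simp add: admissible_def)
  have nonneg: "avg (avg F) x \<ge> 0" if "F \<in> ?S" for F x
    using that cont_avg by (intro avg_nonneg) auto
  have "\<exists>!F. F \<in> ?S \<and> ?T F = F"
  proof (rule Banach_fix)
    show "complete ?S" using closed_admissible_bcontfun complete_eq_closed by blast
    let ?tent = "\<lambda>x::real. max 0 (1 - \<bar>x\<bar>)"
    have "continuous_on UNIV ?tent" by (intro continuous_intros)
    then have tent: "admissible 1 ?tent" by (auto simp: admissible_def)
    then have "Bcontfun ?tent \<in> ?S"
      using admissible_bcontfun[OF tent] by (simp add: Bcontfun_inverse)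
    then show "?S \<noteq> {}" by blast
    show "?T ` ?S \<subseteq> ?S"
    proof
      fix G assume "G \<in> ?T ` ?S"
      then obtain F where "F \<in> ?S" and G: "G = ?T F" by blast
      then show "G \<in> ?S" using T avg2 nonneg by auto
    qed
    show "0 \<le> (2 / 3 :: real)" "2 / 3 < (1 :: real)" by auto
    fix F G assume FG: "F \<in> ?S" "G \<in> ?S"
    show "dist (?T F) (?T G) \<le> 2 / 3 * dist F G"
    proof (rule dist_bound)
      fix x
      let ?h = "\<lambda>x. F x - G x"
      have "admissible 0 ?h" using FG admissible_diff[of 1 F 1 G] by simp
      then have "\<bar>avg (avg ?h) x\<bar> \<le> 2 / 3 * dist F G"
        by (rule abs_avg_avg_le) (metis dist_bounded dist_real_def)
      moreover have "avg (avg ?h) = (\<lambda>x. avg (avg F) x - avg (avg G) x)"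
        using FG by (simp add: avg_diff cont_avg)
      ultimately show "dist (?T F x) (?T G x) \<le> 2 / 3 * dist F G"
        using T FG by (simp add: dist_real_def)
    qed
  qed
  then obtain F where F: "F \<in> ?S" "?T F = F" by blast
  then have fixed: "avg (avg F) = F" using T by metis
  \<comment> \<open>From a fixed point of the square to one of \<open>avg\<close>: averaging changes
    the sign of \<open>?h\<close>, so averaging twice fixes it, and the contraction estimate makes
    it zero.\<close>
  let ?h = "\<lambda>x. F x - avg F x"
  have h: "admissible 0 ?h" using F admissible_diff[of 1 F 1 "avg F"] admissible_avg by fastforce
  have "avg ?h = (\<lambda>x. avg F x - F x)"
    using avg_diff[OF cont cont_avg] F fixed by simp
  then have "avg (avg ?h) = ?h"
    using avg_diff[OF cont_avg cont] F fixed by simp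
  moreover obtain x0 where x0: "\<And>x. \<bar>?h x\<bar> \<le> \<bar>?h x0\<bar>"
    using admissible_attains_sup[OF h] by blast
  ultimately have "\<bar>?h x0\<bar> \<le> 2 / 3 * \<bar>?h x0\<bar>"
    using abs_avg_avg_le[OF h x0, of x0] by simp
  then have "\<bar>?h x0\<bar> = 0" by argo
  then have "?h x = 0" for x using x0[of x] by simp
  then have "avg F = F" by auto
  then show ?thesis using that F by auto
qed

section \<open>Smoothness and positivity of the fixed point\<close>

text \<open>Combinations of rescaled translates form a class that contains all the derivatives of a
  solution of the functional equation.\<close>

inductive dilates :: "(real \<Rightarrow> real) \<Rightarrow> (real \<Rightarrow> real) \<Rightarrow> bool" for p where
  dilate: "dilates p (\<lambda>x. c * p (a * x + b))"
| dilates_add: "dilates p g \<Longrightarrow> dilates p h \<Longrightarrow> dilates p (\<lambda>x. g x + h x)"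

lemma dilates_derivative:
  assumes p: "\<And>x. (p has_real_derivative 2 * (p (2 * x + 1) - p (2 * x - 1))) (at x)"
    and "dilates p g"
  shows "\<exists>g'. dilates p g' \<and> (\<forall>x. (g has_real_derivative g' x) (at x))"
  using assms(2)
proof induction
  case (dilate c a b)
  let ?g' = "\<lambda>x. 2 * a * c * p ((2 * a) * x + (2 * b + 1)) + (- 2 * a * c) * p ((2 * a) * x + (2 * b - 1))"
  have "dilates p ?g'" by (intro dilates.intros)
  moreover have "((\<lambda>x. c * p (a * x + b)) has_real_derivative ?g' x) (at x)" for x
    by (auto intro!: derivative_eq_intros DERIV_chain2[OF p] simp: algebra_simps)
  ultimately show ?case by blast
next
  case (dilates_add g h)
  then obtain g' h' where "dilates p g'" "\<And>x. (g has_real_derivative g' x) (at x)"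
      "dilates p h'" "\<And>x. (h has_real_derivative h' x) (at x)" by blast
  then show ?case
    by (intro exI[of _ "\<lambda>x. g' x + h' x"]) (auto intro: dilates.intros DERIV_add)
qed

lemma smooth_of_functional_equation:
  assumes p: "\<And>x. (p has_real_derivative 2 * (p (2 * x + 1) - p (2 * x - 1))) (at x)"
  shows "smooth p"
proof -
  have "dilates p ((deriv ^^ k) p)" for k
  proof (induction k)
    case 0
    then show ?case using dilate[of p 1 1 0] by simp
  next
    case (Suc k)
    then obtain g' where g': "dilates p g'" "\<And>x. ((deriv ^^ k) p has_real_derivative g' x) (at x)"
      using dilates_derivative[OF p] by blast
    then have "(deriv ^^ Suc k) p = g'" by (auto intro: DERIV_imp_deriv)
    then show ?case using g' by simp
  qed
  then show ?thesis
    using dilates_derivative[OF p] unfolding smooth_def field_differentiable_def by blast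
qed

text \<open>A zero at \<open>x\<close> makes the integral of the nonnegative \<open>p\<close> over
  [2x-1, 2x+1] vanish, so \<open>p\<close> is zero on that whole interval. Moving each time to its
  point nearest to 0 doubles the distance to the boundary of the support, until 0 is reached, where
  \<open>p\<close> is 1.\<close>

lemma avg_fixed_point_pos:
  assumes p: "admissible 1 p" "avg p = p" "\<And>x. p x \<ge> 0" and "\<bar>x\<bar> < 1"
  shows "p x > 0"
proof -
  have cont: "continuous_on A p" for A
    using p(1) continuous_on_subset by (auto simp: admissible_def)
  have p0: "p 0 = 1" using p(1) by (auto simp: admissible_def dest!: bspec[of _ _ 0])
  have zero: "p y = 0" if "p x = 0" "y \<in> {2 * x - 1..2 * x + 1}" for x y
  proof -
    have "integral {2 * x - 1..2 * x + 1} p = 0" using p(2) that(1) unfolding avg_def by metis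
    then show ?thesis
      using integral_eq_0_iff[OF cont, of "2 * x - 1" "2 * x + 1"] p(3) that(2) by auto
  qed
  have "p x > 0" if "\<bar>x\<bar> \<le> 1 - 1 / 2 ^ n" for n x
    using that
  proof (induction n arbitrary: x)
    case 0
    then show ?case using p0 by simp
  next
    case (Suc n)
    show ?case
    proof (rule ccontr)
      assume "\<not> p x > 0"
      then have "p x = 0" using p(3)[of x] by simp
      note z = zero[OF this]
      \<comment> \<open>The point of [2x-1, 2x+1] nearest to 0.\<close>
      let ?y = "if x \<ge> 0 then max 0 (2 * x - 1) else min 0 (2 * x + 1)"
      have x: "\<bar>x\<bar> \<le> 1 - 1 / 2 ^ n / 2" using Suc.prems by simp
      have "\<bar>?y\<bar> \<le> 1 - 1 / 2 ^ n"
        using x by (auto simp: max_def min_def field_simps)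
      moreover have "p ?y = 0" by (rule z) (use x in auto)
      ultimately show False using Suc.IH[of ?y] by simp
    qed
  qed
  moreover obtain n where "(1 / 2 :: real) ^ n < 1 - \<bar>x\<bar>"
    using real_arch_pow_inv[of "1 - \<bar>x\<bar>" "1 / 2"] assms(4) by auto
  ultimately show ?thesis by (metis le_diff_eq add.commute less_imp_le power_one_over)
qed

section \<open>Solutions of the functional equation as fixed points\<close>

lemma avg_fixed_point_of_rvachev_up:
  assumes f: "is_rvachev_up f"
  shows "admissible 1 f \<and> avg f = f"
proof -
  have D: "(f has_real_derivative 2 * (f (2 * x + 1) - f (2 * x - 1))) (at x)" for x
  proof -
    have "(deriv ^^ 0) f field_differentiable at x"
      using f unfolding is_rvachev_up_def smooth_def by blast
    then have "(f has_real_derivative deriv f x) (at x)"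
      by (simp add: DERIV_deriv_iff_field_differentiable)
    then show ?thesis using f by (simp add: is_rvachev_up_def)
  qed
  have cont: "continuous_on UNIV f" by (rule continuous_of_derivative[OF D])
  \<comment> \<open>The closure condition alone leaves the values at 1 and -1 open; the nonzero set
    is open, hence inside the interior of [-1,1].\<close>
  have "open {x. f x \<noteq> 0}"
    using open_Collect_neq[OF cont continuous_on_const] .
  moreover have "{x. f x \<noteq> 0} \<subseteq> {-1..1}"
    using f closure_subset unfolding is_rvachev_up_def by metis
  ultimately have "{x. f x \<noteq> 0} \<subseteq> {-1<..<1}"
    by (metis interior_maximal interior_atLeastAtMost_real)
  then have supp: "f x = 0" if "\<bar>x\<bar> \<ge> 1" for x using that by force
  have f0: "f 0 = 1" using f by (simp add: is_rvachev_up_def)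
  have "f x + f (x - 1) = 1" if "x \<in> {0..1}" for x
  proof -
    \<comment> \<open>In its derivative the terms with argument 2y-1 cancel, leaving two values
      outside the support.\<close>
    let ?\<psi> = "\<lambda>x. f x + f (x - 1)"
    have "?\<psi> x = ?\<psi> 0"
    proof (rule const_of_deriv_eq_0[where \<Phi> = ?\<psi>])
      fix y assume "y \<in> {min x 0..max x 0}"
      then have "f (2 * y + 1) = 0" "f (2 * y - 3) = 0" using that by (auto intro!: supp)
      then show "(?\<psi> has_real_derivative 0) (at y)"
        by (auto intro!: derivative_eq_intros DERIV_chain2[OF D] simp: algebra_simps)
    qed
    then show ?thesis using f0 supp[of "-1"] by simp
  qed
  then have adm: "admissible 1 f" using cont supp by (simp add: admissible_def)
  have "f x = avg f x" for x
  proof -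
    \<comment> \<open>Both functions have the same derivative, and both vanish at 1.\<close>
    have "f x - avg f x = f 1 - avg f 1"
    proof (rule const_of_deriv_eq_0[where \<Phi> = "\<lambda>x. f x - avg f x"])
      fix y
      show "((\<lambda>x. f x - avg f x) has_real_derivative 0) (at y)"
        using DERIV_diff[OF D has_derivative_avg[OF cont]] by simp
    qed
    then show ?thesis using adm admissible_avg[OF adm] by (simp add: admissible_def)
  qed
  then show "admissible 1 f \<and> avg f = f" using adm by auto
qed

lemma rvachev_up_of_avg_fixed_point:
  assumes f: "admissible 1 f" "avg f = f" "\<And>x. f x \<ge> 0"
  shows "is_rvachev_up f"
proof -
  have D: "(f has_real_derivative 2 * (f (2 * x + 1) - f (2 * x - 1))) (at x)" for x
    using has_derivative_avg[of f x] f by (simp add: admissible_def)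
  have "{x. f x \<noteq> 0} = {-1<..<1}"
  proof (intro equalityI subsetI)
    fix x assume "x \<in> {x. f x \<noteq> 0}"
    then show "x \<in> {-1<..<1}"
      using f(1) unfolding admissible_def by (cases "\<bar>x\<bar> \<ge> 1") auto
  next
    fix x :: real assume "x \<in> {-1<..<1}"
    then have "f x > 0" by (intro avg_fixed_point_pos f) auto
    then show "x \<in> {x. f x \<noteq> 0}" by simp
  qed
  then have "closure {x. f x \<noteq> 0} = {-1..1}" by simp
  moreover have "f 0 = 1" using f by (auto simp: admissible_def dest!: bspec[of _ _ 0])
  ultimately show ?thesis
    unfolding is_rvachev_up_def
    using smooth_of_functional_equation[OF D] DERIV_imp_deriv[OF D] by simp
qed

lemma is_rvachev_up_rvachev_up: "is_rvachev_up rvachev_up"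
proof -
  obtain p where p: "admissible 1 p" "avg p = p" "\<And>x. p x \<ge> 0"
    using ex_avg_fixed_point by blast
  have "\<exists>!f. is_rvachev_up f"
    using rvachev_up_of_avg_fixed_point[OF p] avg_fixed_point_of_rvachev_up avg_fixed_point_unique
    by blast
  then show ?thesis unfolding rvachev_up_def by (rule theI')
qed

lemma admissible_rvachev_up: "admissible 1 rvachev_up"
  and avg_rvachev_up: "avg rvachev_up = rvachev_up"
  using avg_fixed_point_of_rvachev_up[OF is_rvachev_up_rvachev_up] by auto

lemma continuous_rvachev_up: "continuous_on A rvachev_up"
  using admissible_rvachev_up continuous_on_subset unfolding admissible_def by blast

lemma rvachev_up_eq_0: "\<bar>x\<bar> \<ge> 1 \<Longrightarrow> rvachev_up x = 0"
  using admissible_rvachev_up by (simp add: admissible_def)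

lemma rvachev_up_derivative:
  "(rvachev_up has_real_derivative 2 * (rvachev_up (2 * x + 1) - rvachev_up (2 * x - 1))) (at x)"
  using has_derivative_avg[OF continuous_rvachev_up] by (simp add: avg_rvachev_up)

text \<open>The reflected function is also an admissible fixed point, so uniqueness applies.\<close>

lemma rvachev_up_minus: "rvachev_up (- x) = rvachev_up x"
proof -
  let ?g = "\<lambda>x. rvachev_up (- x)"
  have "rvachev_up (- x) + rvachev_up (1 - x) = 1" if "x \<in> {0..1}" for x
    using admissible_rvachev_up that unfolding admissible_def
    by (auto dest!: bspec[of _ _ "1 - x"])
  then have "admissible 1 ?g"
    using admissible_rvachev_up
    by (auto simp: admissible_def intro!: continuous_on_compose2[OF continuous_rvachev_up] continuous_intros)
  moreover have "avg ?g = ?g"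
  proof
    fix x
    have "avg ?g x = avg rvachev_up (- x)"
      using Henstock_Kurzweil_Integration.integral_reflect_real[of "- 2 * x + 1" "- 2 * x - 1" rvachev_up] by (simp add: avg_def add.commute)
    then show "avg ?g x = ?g x" by (simp add: avg_rvachev_up)
  qed
  ultimately have "?g = rvachev_up"
    using avg_fixed_point_unique admissible_rvachev_up avg_rvachev_up by blast
  then show ?thesis by metis
qed

section \<open>Moments of the Rvachev function\<close>

definition expect :: "(real \<Rightarrow> real) \<Rightarrow> real" where
  "expect P = integral {-1..1} (\<lambda>t. P t * rvachev_up t)"

lemma integrable_expect:
  assumes "continuous_on UNIV P"
  shows "(\<lambda>t. P t * rvachev_up t) integrable_on {-1..1}"
  by (intro integrable_continuous_real continuous_intros continuous_rvachev_up
      continuous_on_subset[OF assms]) simp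

lemma expect_cmult: "expect (\<lambda>t. c * P t) = c * expect P"
  by (simp add: expect_def mult.assoc)

lemma expect_add:
  assumes "continuous_on UNIV P" "continuous_on UNIV Q"
  shows "expect (\<lambda>t. P t + Q t) = expect P + expect Q"
  unfolding expect_def distrib_right
  by (intro Henstock_Kurzweil_Integration.integral_add integrable_expect assms)

lemma expect_sum:
  assumes "finite A" "\<And>i. continuous_on UNIV (P i)"
  shows "expect (\<lambda>t. \<Sum>i\<in>A. c i * P i t) = (\<Sum>i\<in>A. c i * expect (P i))"
  using assms(1)
proof induction
  case empty
  then show ?case by (simp add: expect_def)
next
  case (insert i A)
  have "expect (\<lambda>t. \<Sum>i\<in>insert i A. c i * P i t) = expect (\<lambda>t. c i * P i t + (\<Sum>i\<in>A. c i * P i t))"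
    using insert by simp
  also have "\<dots> = c i * expect (P i) + expect (\<lambda>t. \<Sum>i\<in>A. c i * P i t)"
    by (subst expect_add) (auto intro!: continuous_intros assms(2) simp: expect_cmult)
  finally show ?case using insert by simp
qed

lemma expect_minus: "expect (\<lambda>t. P (- t)) = expect P"
  using Henstock_Kurzweil_Integration.integral_reflect_real[of 1 "-1" "\<lambda>t. P t * rvachev_up t"]
  by (simp add: expect_def rvachev_up_minus)

text \<open>Being constant outside [-1,1], the antiderivative yields the expectation from any two
  points beyond the ends, such as values of 2t+1 and 2t-1.\<close>

lemma antiderivative_expect:
  assumes "continuous_on UNIV P"
  obtains \<Psi> where "\<And>t. (\<Psi> has_real_derivative P t * rvachev_up t) (at t)"
    and "\<And>t. t \<ge> 1 \<Longrightarrow> \<Psi> t = \<Psi> (-1) + expect P"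
    and "\<And>t. t \<le> -1 \<Longrightarrow> \<Psi> t = \<Psi> (-1)"
proof -
  have "continuous_on UNIV (\<lambda>t. P t * rvachev_up t)"
    by (intro continuous_intros assms continuous_rvachev_up)
  then obtain \<Psi> where \<Psi>: "\<And>t. (\<Psi> has_real_derivative P t * rvachev_up t) (at t)"
    using ex_antiderivative by blast
  have zero: "(\<Psi> has_real_derivative 0) (at t)" if "\<bar>t\<bar> \<ge> 1" for t
    using \<Psi>[of t] rvachev_up_eq_0[OF that] by simp
  have total: "\<Psi> 1 - \<Psi> (-1) = expect P"
    unfolding expect_def by (rule integral_antiderivative[symmetric]) (auto intro: \<Psi>)
  show ?thesis
  proof (rule that[of \<Psi>, OF \<Psi>])
    fix t :: real assume "t \<ge> 1"
    then have "\<Psi> t = \<Psi> 1"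
      by (intro const_of_deriv_eq_0[where \<Phi> = \<Psi>]) (auto intro!: zero)
    then show "\<Psi> t = \<Psi> (-1) + expect P" using total by simp
  next
    fix t :: real assume "t \<le> -1"
    then show "\<Psi> t = \<Psi> (-1)"
      by (intro const_of_deriv_eq_0[where \<Phi> = \<Psi>]) (auto intro!: zero)
  qed
qed

lemma expect_1: "expect (\<lambda>_. 1) = 1"
proof -
  obtain \<Psi> where \<Psi>: "\<And>t. (\<Psi> has_real_derivative 1 * rvachev_up t) (at t)"
    "\<And>t. t \<ge> 1 \<Longrightarrow> \<Psi> t = \<Psi> (-1) + expect (\<lambda>_. 1)"
    using antiderivative_expect[of "\<lambda>_. 1"] by (metis continuous_on_const)
  then show ?thesis
    using antiderivative_total[OF admissible_rvachev_up, of \<Psi>] by simp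
qed

text \<open>Integration by parts, with the functional equation substituted for the derivative of
  the Rvachev function.\<close>

lemma expect_derivative:
  assumes P: "\<And>t. (P has_real_derivative P' t) (at t)" and P': "continuous_on UNIV P'"
  shows "expect P' = expect (\<lambda>t. P ((t + 1) / 2)) - expect (\<lambda>t. P ((t - 1) / 2))"
proof -
  note cont = continuous_of_derivative[OF P]
  have "continuous_on UNIV (\<lambda>t. P ((t + 1) / 2))" "continuous_on UNIV (\<lambda>t. P ((t - 1) / 2))"
    by (auto intro!: continuous_on_compose2[OF cont] continuous_intros)
  note 1 = antiderivative_expect[OF this(1)] and 2 = antiderivative_expect[OF this(2)]
  obtain \<Psi> where \<Psi>: "\<And>t. (\<Psi> has_real_derivative P ((t + 1) / 2) * rvachev_up t) (at t)"
    "\<And>t. t \<ge> 1 \<Longrightarrow> \<Psi> t = \<Psi> (-1) + expect (\<lambda>t. P ((t + 1) / 2))"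
    "\<And>t. t \<le> -1 \<Longrightarrow> \<Psi> t = \<Psi> (-1)" using 1 by blast
  obtain \<Xi> where \<Xi>: "\<And>t. (\<Xi> has_real_derivative P ((t - 1) / 2) * rvachev_up t) (at t)"
    "\<And>t. t \<ge> 1 \<Longrightarrow> \<Xi> t = \<Xi> (-1) + expect (\<lambda>t. P ((t - 1) / 2))"
    "\<And>t. t \<le> -1 \<Longrightarrow> \<Xi> t = \<Xi> (-1)" using 2 by blast
  \<comment> \<open>The two corrections cancel the terms that the functional equation contributes to
    the derivative of \<open>P t * rvachev_up t\<close>.\<close>
  let ?K = "\<lambda>t. P t * rvachev_up t - \<Xi> (2 * t + 1) + \<Psi> (2 * t - 1)"
  have "(?K has_real_derivative P' t * rvachev_up t) (at t)" for t
    by (auto intro!: derivative_eq_intros P rvachev_up_derivative DERIV_chain2[OF \<Psi>(1)]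
        DERIV_chain2[OF \<Xi>(1)] simp: algebra_simps)
  then have "expect P' = ?K 1 - ?K (-1)"
    unfolding expect_def by (intro integral_antiderivative) auto
  then show ?thesis
    using \<Psi>(2)[of 1] \<Psi>(3)[of "-3"] \<Xi>(2)[of 3] by (simp add: rvachev_up_eq_0)
qed

section \<open>Values at the points 1 - 2^(-n)\<close>

definition half_moment :: "nat \<Rightarrow> real" where
  "half_moment n = expect (\<lambda>t. ((1 + t) / 2) ^ n)"

text \<open>The left end -1 of the support sits at \<open>x = 0\<close>. The weight arises from
  repeated integration by parts, and at \<open>m = 0\<close> the whole support is covered.\<close>

definition dyadic_integral :: "nat \<Rightarrow> nat \<Rightarrow> real" where
  "dyadic_integral k m = integral {0..1} (\<lambda>x. (1 - x) ^ k * rvachev_up (2 * x / 2 ^ m - 1))"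

text \<open>This close to the left end, the second term of the functional equation is evaluated at
  or below -1 and drops out.\<close>

lemma rvachev_up_left_derivative:
  assumes "x \<le> 1"
  shows "((\<lambda>x. rvachev_up (2 * x / 2 ^ Suc m - 1)) has_real_derivative
    2 / 2 ^ m * rvachev_up (2 * x / 2 ^ m - 1)) (at x)"
proof -
  have "2 * (2 * x / 2 ^ Suc m - 1) - 1 \<le> -1"
  proof -
    have "x \<le> 2 ^ m" using assms one_le_power[of "2::real" m] by linarith
    then show ?thesis by (simp add: field_simps)
  qed
  then have 0: "rvachev_up (2 * (2 * x / 2 ^ Suc m - 1) - 1) = 0" by (intro rvachev_up_eq_0) linarith
  have "((\<lambda>x. rvachev_up (2 * x / 2 ^ Suc m - 1)) has_real_derivative
      2 * (rvachev_up (2 * (2 * x / 2 ^ Suc m - 1) + 1)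
        - rvachev_up (2 * (2 * x / 2 ^ Suc m - 1) - 1)) * (2 / 2 ^ Suc m)) (at x)"
    by (rule DERIV_chain2[OF rvachev_up_derivative]) (auto intro!: derivative_eq_intros)
  then show ?thesis using 0 by (simp add: algebra_simps)
qed

text \<open>Integration by parts; the boundary terms vanish, at 1 because of the weight and at 0
  because up(-1) = 0.\<close>

lemma dyadic_integral_Suc:
  "real (Suc k) * dyadic_integral k (Suc m) = 2 / 2 ^ m * dyadic_integral (Suc k) m"
proof -
  let ?f = "\<lambda>m x. rvachev_up (2 * x / 2 ^ m - 1)"
  have cont: "continuous_on {0..1} (\<lambda>x. (1 - x) ^ k * ?f m x)" for k m
    by (intro continuous_intros continuous_on_compose2[OF continuous_rvachev_up[of UNIV]]) auto
  then have int: "(\<lambda>x. c * ((1 - x) ^ k * ?f m x)) integrable_on {0..1}" for c k m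
    by (intro integrable_continuous_real continuous_on_mult_left)
  have "integral {0..1} (\<lambda>x. real (Suc k) * ((1 - x) ^ k * ?f (Suc m) x)
      - 2 / 2 ^ m * ((1 - x) ^ Suc k * ?f m x)) = 
    - ((1 - 1) ^ Suc k * ?f (Suc m) 1) - - ((1 - 0) ^ Suc k * ?f (Suc m) 0)"
  proof (rule integral_antiderivative)
    fix x :: real assume x: "x \<in> {0..1}"
    have "((\<lambda>x. (1 - x) ^ Suc k) has_real_derivative (1 + real k) * (- 1 * (1 - x) ^ k)) (at x)"
      by (rule DERIV_power_Suc) (auto intro!: derivative_eq_intros)
    note DERIV_minus[OF DERIV_mult[OF this rvachev_up_left_derivative[of x m]]]
    then show "((\<lambda>x. - ((1 - x) ^ Suc k * ?f (Suc m) x)) has_real_derivative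
        real (Suc k) * ((1 - x) ^ k * ?f (Suc m) x) - 2 / 2 ^ m * ((1 - x) ^ Suc k * ?f m x)) (at x)"
      by (rule DERIV_cong) (use x in \<open>simp_all add: algebra_simps del: power_Suc\<close>)
  qed simp
  also have "\<dots> = 0" by (simp add: rvachev_up_eq_0)
  also have "integral {0..1} (\<lambda>x. real (Suc k) * ((1 - x) ^ k * ?f (Suc m) x)
      - 2 / 2 ^ m * ((1 - x) ^ Suc k * ?f m x)) =
    real (Suc k) * dyadic_integral k (Suc m) - 2 / 2 ^ m * dyadic_integral (Suc k) m"
    unfolding dyadic_integral_def
    by (subst Henstock_Kurzweil_Integration.integral_diff[OF int int])
      (simp del: of_nat_Suc power_Suc)
  finally show ?thesis by simp
qed

lemma dyadic_integral_0: "dyadic_integral n 0 = half_moment n / 2"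
proof -
  have "continuous_on UNIV (\<lambda>t::real. ((1 + - t) / 2) ^ n)" by (intro continuous_intros) auto
  note antiderivative_expect[OF this]
  then obtain \<Psi> where \<Psi>: "\<And>t. (\<Psi> has_real_derivative ((1 + - t) / 2) ^ n * rvachev_up t) (at t)"
    "\<And>t. t \<ge> 1 \<Longrightarrow> \<Psi> t = \<Psi> (-1) + expect (\<lambda>t. ((1 + - t) / 2) ^ n)"
    by metis
  have "dyadic_integral n 0 = \<Psi> (2 * 1 - 1) / 2 - \<Psi> (2 * 0 - 1) / 2"
    unfolding dyadic_integral_def
  proof (rule integral_antiderivative)
    fix x :: real
    have "((\<lambda>x. \<Psi> (2 * x - 1)) has_real_derivative
        ((1 + - (2 * x - 1)) / 2) ^ n * rvachev_up (2 * x - 1) * 2) (at x)"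
      by (rule DERIV_chain2[OF \<Psi>(1)]) (auto intro!: derivative_eq_intros)
    note D = DERIV_cdivide[OF this, of 2]
    have "(1 + - (2 * x - 1)) / 2 = 1 - x" by (simp add: field_simps)
    then show "((\<lambda>x. \<Psi> (2 * x - 1) / 2) has_real_derivative
        (1 - x) ^ n * rvachev_up (2 * x / 2 ^ 0 - 1)) (at x)"
      by (intro DERIV_cong[OF D]) (simp only:, simp)
  qed simp
  then show ?thesis
    using \<Psi>(2)[of 1] expect_minus[of "\<lambda>t. ((1 + t) / 2) ^ n"] by (simp add: half_moment_def add_divide_distrib)
qed

text \<open>The factors 2 / 2^m of \<open>dyadic_integral_Suc\<close>, for m from n - j to n - 1,
  multiply to 2^j times the quotient of the two binomial powers.\<close>

lemma dyadic_integral_shift: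
  "dyadic_integral 0 n * (fact j * 2 ^ (n choose 2)) =
     2 ^ j * 2 ^ ((n - j) choose 2) * dyadic_integral j (n - j)" if "j \<le> n"
  using that
proof (induction j)
  case (Suc j)
  define m where "m = n - Suc j"
  have m: "n - j = Suc m" using Suc.prems by (simp add: m_def)
  have c: "Suc m choose 2 = m + (m choose 2)" by (simp add: numeral_2_eq_2)
  have "dyadic_integral 0 n * (fact (Suc j) * 2 ^ (n choose 2)) =
      real (Suc j) * (dyadic_integral 0 n * (fact j * 2 ^ (n choose 2)))"
    by (simp add: algebra_simps)
  also have "\<dots> = 2 ^ j * 2 ^ (Suc m choose 2) * (real (Suc j) * dyadic_integral j (Suc m))"
    using Suc m by (simp add: algebra_simps)
  also have "\<dots> = 2 ^ Suc j * 2 ^ (m choose 2) * dyadic_integral (Suc j) m"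
    unfolding dyadic_integral_Suc c by (simp add: power_add)
  finally show ?case by (simp add: m_def)
qed simp

lemma rvachev_up_dyadic:
  "rvachev_up (1 - 1 / 2 ^ n) = half_moment n / (2 ^ (n choose 2) * fact n)"
proof -
  \<comment> \<open>One integration of the derivative starts the chain;
    \<open>dyadic_integral_shift\<close> with \<open>j = n\<close> then ends at scale 0.\<close>
  have "integral {0..1} (\<lambda>x. 2 / 2 ^ n * rvachev_up (2 * x / 2 ^ n - 1)) =
      rvachev_up (2 * 1 / 2 ^ Suc n - 1) - rvachev_up (2 * 0 / 2 ^ Suc n - 1)"
    by (rule integral_antiderivative[OF _ rvachev_up_left_derivative]) auto
  then have "2 / 2 ^ n * dyadic_integral 0 n = rvachev_up (1 / 2 ^ n - 1)"
    by (simp add: dyadic_integral_def rvachev_up_eq_0)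
  also have "\<dots> = rvachev_up (1 - 1 / 2 ^ n)"
    using rvachev_up_minus[of "1 - 1 / 2 ^ n"] by simp
  finally have "rvachev_up (1 - 1 / 2 ^ n) = 2 / 2 ^ n * dyadic_integral 0 n" ..
  moreover have "dyadic_integral 0 n * (fact n * 2 ^ (n choose 2)) = 2 ^ n * (half_moment n / 2)"
    using dyadic_integral_shift[of n n] dyadic_integral_0 by (simp add: numeral_2_eq_2)
  ultimately have "rvachev_up (1 - 1 / 2 ^ n) * (2 ^ (n choose 2) * fact n) = half_moment n"
    by (simp add: algebra_simps)
  then show ?thesis by (simp add: eq_divide_eq)
qed

lemma fabius_dyadic:
  assumes "n \<ge> 1"
  shows "fabius (1 / 2 ^ n) = rvachev_up (1 - 1 / 2 ^ n)"
proof -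
  have le: "1 / 2 ^ n \<le> (1::real)" by simp
  have "rvachev_up (1 / 2 ^ n - 2 * real m - 1) = 0" if "m \<noteq> 0" for m
  proof -
    have "real m \<ge> 1" using that by simp
    then show ?thesis using le by (intro rvachev_up_eq_0) linarith
  qed
  then have "fabius (1 / 2 ^ n) =
      (\<Sum>m\<in>{0}. (-1) ^ binary_digit_sum m * rvachev_up (1 / 2 ^ n - 2 * real m - 1))"
    unfolding fabius_def by (intro suminf_finite) auto
  also have "\<dots> = rvachev_up (- (1 - 1 / 2 ^ n))" by (simp add: binary_digit_sum_def)
  finally show ?thesis by (simp only: rvachev_up_minus)
qed

section \<open>Moments and their denominators\<close>

definition moment :: "nat \<Rightarrow> real" where
  "moment n = expect (\<lambda>t. t ^ n)"

lemma moment_0: "moment 0 = 1"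
  by (simp add: moment_def expect_1)

lemma moment_odd: "odd n \<Longrightarrow> moment n = 0"
  using expect_minus[of "\<lambda>t. t ^ n"] expect_cmult[of "-1" "\<lambda>t. t ^ n"]
  by (simp add: moment_def)

lemma half_moment_eq_sum_moments:
  "2 ^ n * half_moment n = (\<Sum>i\<le>n. real (n choose i) * moment i)"
proof -
  have "2 ^ n * half_moment n = expect (\<lambda>t. 2 ^ n * ((1 + t) / 2) ^ n)"
    by (simp only: half_moment_def expect_cmult)
  also have "(\<lambda>t. 2 ^ n * ((1 + t) / 2) ^ n) = (\<lambda>t::real. \<Sum>i\<le>n. real (n choose i) * t ^ i)"
    using binomial_ring[of _ "1::real" n] by (simp add: power_divide add.commute)
  also have "expect \<dots> = (\<Sum>i\<le>n. real (n choose i) * moment i)"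
    unfolding moment_def by (rule expect_sum) (auto intro!: continuous_intros)
  finally show ?thesis .
qed

lemma half_moment_minus: "half_moment n = expect (\<lambda>t. ((1 - t) / 2) ^ n)"
  using expect_minus[of "\<lambda>t. ((1 + t) / 2) ^ n"] by (simp add: half_moment_def)

lemma two_half_moment:
  "2 * half_moment n = expect (\<lambda>t. ((1 + t) / 2) ^ n + ((1 - t) / 2) ^ n)"
  using half_moment_minus[of n]
  by (subst expect_add) (auto intro!: continuous_intros simp: half_moment_def)

text \<open>Take \<open>P\<close> to be the power 2k+1 in \<open>expect_derivative\<close>. The
  exponent is odd and up is even, so the two expectations are opposite.\<close>

lemma moment_even_eq_half_moment:
  "real (2 * k + 1) * moment (2 * k) = 2 * half_moment (2 * k + 1)"
proof -
  let ?n = "2 * k + 1"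
  have "expect (\<lambda>t. real ?n * t ^ (2 * k)) =
      expect (\<lambda>t. ((t + 1) / 2) ^ ?n) - expect (\<lambda>t. ((t - 1) / 2) ^ ?n)"
  proof (rule expect_derivative[where P = "\<lambda>t. t ^ ?n"])
    show "((\<lambda>t. t ^ ?n) has_real_derivative real ?n * t ^ (2 * k)) (at t)" for t :: real
      using DERIV_pow[of ?n t] by simp
  qed (intro continuous_intros)
  moreover have "(\<lambda>t. ((t - 1) / 2) ^ ?n) = (\<lambda>t::real. - 1 * ((1 - t) / 2) ^ ?n)"
  proof
    fix t :: real
    have "(t - 1) / 2 = - ((1 - t) / 2)" by (simp add: field_simps)
    then show "((t - 1) / 2) ^ ?n = - 1 * ((1 - t) / 2) ^ ?n"
      by (simp only: power_minus_odd) simp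
  qed
  ultimately show ?thesis
    using half_moment_minus[of ?n] expect_cmult[of "-1" "\<lambda>t. ((1 - t) / 2) ^ ?n"]
    by (simp only: expect_cmult moment_def half_moment_def add.commute[of _ 1])
qed

text \<open>In the binomial expansion of 2^(2k+1) d_(2k+1) the top moment is odd and vanishes;
  moving the next one to the left turns 4^k into 4^k - 1.\<close>

lemma moment_even_recurrence:
  "real (2 * k + 1) * (4 ^ k - 1) * moment (2 * k) =
     (\<Sum>i<2 * k. real (2 * k + 1 choose i) * moment i)"
proof -
  have "4 ^ k * (real (2 * k + 1) * moment (2 * k)) = 2 ^ (2 * k + 1) * half_moment (2 * k + 1)"
    unfolding moment_even_eq_half_moment by (simp add: power_mult)
  also have "\<dots> = (\<Sum>i\<le>2 * k + 1. real (2 * k + 1 choose i) * moment i)"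
    by (rule half_moment_eq_sum_moments)
  also have "{..2 * k + 1} = insert (2 * k + 1) (insert (2 * k) {..<2 * k})" by auto
  also have "(\<Sum>i\<in>\<dots>. real (2 * k + 1 choose i) * moment i) =
      real (2 * k + 1) * moment (2 * k) + (\<Sum>i<2 * k. real (2 * k + 1 choose i) * moment i)"
    using binomial_symmetric[of "2 * k" "2 * k + 1"] by (simp add: moment_odd)
  finally show ?thesis by (simp add: algebra_simps)
qed

text \<open>The product of the leading coefficients in
  \<open>moment_even_recurrence\<close>.\<close>

definition moment_denominator :: "nat \<Rightarrow> nat" where
  "moment_denominator k = (\<Prod>m = 1..k. (2 * m + 1) * (4 ^ m - 1))"

lemma moment_denominator_Suc:
  "real (moment_denominator (Suc k)) =
     real (moment_denominator k) * (real (2 * Suc k + 1) * (4 ^ Suc k - 1))"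
proof -
  have "moment_denominator (Suc k) =
      moment_denominator k * ((2 * Suc k + 1) * (4 ^ Suc k - 1))"
    by (simp add: moment_denominator_def)
  moreover have "real (4 ^ Suc k - 1) = 4 ^ Suc k - 1" by (subst of_nat_diff) simp_all
  ultimately show ?thesis by (simp only: of_nat_mult)
qed

lemma moment_denominator_dvd: "j \<le> k \<Longrightarrow> moment_denominator j dvd moment_denominator k"
  unfolding moment_denominator_def by (rule prod_dvd_prod_subset) auto

lemma sum_in_Nats: "(\<And>i. i \<in> A \<Longrightarrow> f i \<in> \<nat>) \<Longrightarrow> sum f A \<in> \<nat>"
  by (induction A rule: infinite_finite_induct) (auto intro: Nats_add)

text \<open>All coefficients of the recurrence are nonnegative, hence naturals and not merely
  integers. The bound 2k+1 lets one denominator serve every moment on the right-hand side.\<close>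

lemma moment_denominator_mult_moment:
  assumes "i \<le> 2 * k + 1"
  shows "real (moment_denominator k) * moment i \<in> \<nat>"
  using assms
proof (induction i arbitrary: k rule: less_induct)
  case (less i)
  consider "odd i" | "i = 0" | j where "i = 2 * Suc j"
    by (metis evenE gr0_conv_Suc mult_0_right not_gr_zero)
  then show ?case
  proof cases
    case 3
    let ?D = "\<lambda>k. real (moment_denominator k)"
    have "?D (Suc j) * moment i = ?D j * (\<Sum>l<2 * Suc j. real (2 * Suc j + 1 choose l) * moment l)"
      unfolding moment_even_recurrence[symmetric] 3 by (simp add: moment_denominator_Suc mult_ac)
    also have "\<dots> = (\<Sum>l<2 * Suc j. real (2 * Suc j + 1 choose l) * (?D j * moment l))"
      unfolding sum_distrib_left by (intro sum.cong) auto
    also have "\<dots> \<in> \<nat>"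
      by (intro sum_in_Nats Nats_mult less.IH) (use 3 in auto)
    finally have *: "?D (Suc j) * moment i \<in> \<nat>" .
    have "Suc j \<le> k" using less.prems 3 by simp
    then obtain c where "moment_denominator k = moment_denominator (Suc j) * c"
      using moment_denominator_dvd by (meson dvdE)
    then have "?D k * moment i = real c * (?D (Suc j) * moment i)" by (simp add: mult_ac)
    then show ?thesis using Nats_mult[OF of_nat_in_Nats[of c] *] by metis
  qed (auto simp: moment_odd moment_0)
qed

section \<open>Power sums in the product variable\<close>

text \<open>Coefficients of the polynomials S that express \<open>u ^ n + v ^ n\<close> through \<open>z = u * v\<close> when
  \<open>u + v = 1\<close>: \<open>S 0 = 2\<close>, \<open>S 1 = 1\<close> and \<open>S (n + 2) = S (n + 1) - z * S n\<close>.\<close>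

fun power_sum_coeff :: "nat \<Rightarrow> nat \<Rightarrow> int" where
  "power_sum_coeff 0 l = (if l = 0 then 2 else 0)"
| "power_sum_coeff (Suc 0) l = (if l = 0 then 1 else 0)"
| "power_sum_coeff (Suc (Suc n)) 0 = power_sum_coeff (Suc n) 0"
| "power_sum_coeff (Suc (Suc n)) (Suc l) = power_sum_coeff (Suc n) (Suc l) - power_sum_coeff n l"

text \<open>The free bound \<open>N\<close> lets expansions for different \<open>n\<close> share one
  index range, so that they can be added and interchanged with other sums.\<close>

lemma power_sum_eq:
  fixes u v :: real
  assumes "u + v = 1" "n \<le> N"
  shows "u ^ n + v ^ n = (\<Sum>l\<le>N. of_int (power_sum_coeff n l) * (u * v) ^ l)"
  using assms(2)
proof (induction n arbitrary: N rule: induct_nat_012)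
  case 0
  then show ?case by (simp add: if_distrib if_distribR sum.delta cong: if_cong)
next
  case 1
  then show ?case using assms(1) by (simp add: if_distrib if_distribR sum.delta cong: if_cong)
next
  case (ge2 n)
  then obtain M where N: "N = Suc M" using Suc_le_D by blast
  have v: "v = 1 - u" using assms(1) by simp
  have "u ^ Suc (Suc n) + v ^ Suc (Suc n) = (u ^ Suc n + v ^ Suc n) - u * v * (u ^ n + v ^ n)"
    unfolding v by (simp add: algebra_simps)
  also have "\<dots> = (\<Sum>l\<le>Suc M. of_int (power_sum_coeff (Suc n) l) * (u * v) ^ l) -
      u * v * (\<Sum>l\<le>M. of_int (power_sum_coeff n l) * (u * v) ^ l)"
    using ge2.IH(1)[of M] ge2.IH(2)[of "Suc M"] ge2.prems N by simp
  also have "\<dots> = (\<Sum>l\<le>N. of_int (power_sum_coeff (Suc (Suc n)) l) * (u * v) ^ l)"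
    unfolding N sum.atMost_Suc_shift sum_distrib_left add_diff_eq[symmetric] sum_subtractf[symmetric]
    by (intro arg_cong2[where f = plus] sum.cong) (simp_all add: algebra_simps)
  finally show ?case .
qed

lemma power_sum_coeff_eq_0: "n < 2 * l \<Longrightarrow> power_sum_coeff n l = 0"
proof (induction n arbitrary: l rule: induct_nat_012)
  case (ge2 n)
  then show ?case by (cases l) auto
qed auto

text \<open>At z = 0 one of u, v is 1 and the other is 0. This constant term is what makes 2 d_n
  odd.\<close>

lemma power_sum_coeff_0: "power_sum_coeff (Suc n) 0 = 1"
  by (induction n) auto

text \<open>The recursion couples the two parities, so they are proved together. The factor 2i+1
  later cancels the denominator on the diagonal.\<close>

lemma power_sum_coeff_top:
  "power_sum_coeff (2 * i) i = 2 * (-1) ^ i"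
  "power_sum_coeff (2 * i + 1) i = (-1) ^ i * (2 * int i + 1)"
proof (induction i)
  case (Suc i)
  {
    case 1
    show ?case using Suc power_sum_coeff_eq_0[of "2 * i + 1" "Suc i"] by simp
  next
    case 2
    have "power_sum_coeff (2 * Suc i) (Suc i) = 2 * (-1) ^ Suc i"
      using Suc power_sum_coeff_eq_0[of "2 * i + 1" "Suc i"] by simp
    then show ?case using Suc by (simp add: algebra_simps)
  }
qed auto

text \<open>The numbers w_j, with z = u * v for u = (1 + t) / 2 and v = (1 - t) / 2.\<close>

definition quad_moment :: "nat \<Rightarrow> real" where
  "quad_moment j = expect (\<lambda>t. ((1 - t\<^sup>2) / 4) ^ j)"

lemma two_half_moment_eq_quad_moments:
  assumes "n \<le> N"
  shows "2 * half_moment n = (\<Sum>l\<le>N. of_int (power_sum_coeff n l) * quad_moment l)"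
proof -
  have "(\<lambda>t. ((1 + t) / 2) ^ n + ((1 - t) / 2) ^ n) =
    (\<lambda>t::real. \<Sum>l\<le>N. of_int (power_sum_coeff n l) * ((1 - t\<^sup>2) / 4) ^ l)"
  proof
    fix t :: real
    have "(1 + t) / 2 * ((1 - t) / 2) = (1 - t\<^sup>2) / 4"
      by (simp add: algebra_simps power2_eq_square)
    then show "((1 + t) / 2) ^ n + ((1 - t) / 2) ^ n =
        (\<Sum>l\<le>N. of_int (power_sum_coeff n l) * ((1 - t\<^sup>2) / 4) ^ l)"
      using power_sum_eq[of "(1 + t) / 2" "(1 - t) / 2" n N] assms by (simp add: field_simps)
  qed
  then show ?thesis
    unfolding two_half_moment quad_moment_def
    by (simp only:) (rule expect_sum, auto intro!: continuous_intros)
qed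

lemma quad_moment_eq_moments:
  "4 ^ j * quad_moment j = (\<Sum>i\<le>j. (-1) ^ i * real (j choose i) * moment (2 * i))"
proof -
  have "4 ^ j * quad_moment j = expect (\<lambda>t. 4 ^ j * ((1 - t\<^sup>2) / 4) ^ j)"
    by (simp only: quad_moment_def expect_cmult)
  also have "(\<lambda>t. 4 ^ j * ((1 - t\<^sup>2) / 4) ^ j) =
      (\<lambda>t::real. \<Sum>i\<le>j. ((-1) ^ i * real (j choose i)) * t ^ (2 * i))"
  proof
    fix t :: real
    have "4 ^ j * ((1 - t\<^sup>2) / 4) ^ j = (- t\<^sup>2 + 1) ^ j" by (simp add: power_divide)
    also have "\<dots> = (\<Sum>i\<le>j. ((-1) ^ i * real (j choose i)) * t ^ (2 * i))"
      unfolding binomial_ring by (auto intro!: sum.cong simp: power_mult power_minus[of "t\<^sup>2"])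
    finally show "4 ^ j * ((1 - t\<^sup>2) / 4) ^ j = \<dots>" .
  qed
  also have "expect \<dots> = (\<Sum>i\<le>j. (-1) ^ i * real (j choose i) * moment (2 * i))"
    unfolding moment_def by (rule expect_sum) (auto intro!: continuous_intros)
  finally show ?thesis .
qed

section \<open>Divisibility by 2\<close>

text \<open>The integers localized at the prime 2, taken inside the reals because the moments are
  real numbers.\<close>

definition two_integral :: "real \<Rightarrow> bool" where
  "two_integral x \<longleftrightarrow> (\<exists>a b :: int. odd b \<and> x = of_int a / of_int b)"

lemma two_integral_of_int: "two_integral (of_int a)"
  unfolding two_integral_def by (intro exI[of _ a] exI[of _ 1]) simp

lemma two_integral_add:
  assumes "two_integral x" "two_integral y"
  shows "two_integral (x + y)"
proof -
  obtain a b c d :: int where "odd b" "x = of_int a / of_int b" "odd d" "y = of_int c / of_int d"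
    using assms unfolding two_integral_def by blast
  moreover from this have "b \<noteq> 0" "d \<noteq> 0" by auto
  ultimately show ?thesis
    unfolding two_integral_def
    by (intro exI[of _ "a * d + c * b"] exI[of _ "b * d"]) (simp add: field_simps)
qed

lemma two_integral_mult:
  assumes "two_integral x" "two_integral y"
  shows "two_integral (x * y)"
proof -
  obtain a b c d :: int where "odd b" "x = of_int a / of_int b" "odd d" "y = of_int c / of_int d"
    using assms unfolding two_integral_def by blast
  then show ?thesis
    unfolding two_integral_def by (intro exI[of _ "a * c"] exI[of _ "b * d"]) simp
qed

lemma two_integral_divide:
  assumes "two_integral x" "odd m"
  shows "two_integral (x / of_int m)"
proof -
  have "two_integral (1 / of_int m)"
    using assms(2) unfolding two_integral_def by (intro exI[of _ 1] exI[of _ m]) simp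
  then show ?thesis using two_integral_mult[OF assms(1)] by fastforce
qed

lemma two_integral_sum: "(\<And>i. i \<in> A \<Longrightarrow> two_integral (f i)) \<Longrightarrow> two_integral (sum f A)"
  using two_integral_of_int[of 0]
  by (induction A rule: infinite_finite_induct) (auto intro: two_integral_add)

text \<open>The expanded form of the Wallis integral of (1 - x^2)^j over [0,1].\<close>

definition wallis_sum :: "nat \<Rightarrow> real" where
  "wallis_sum j = (\<Sum>i\<le>j. (-1) ^ i * real (j choose i) / real (2 * i + 1))"

text \<open>By absorption, the i-th summand of the difference of the two sides is (-1)^i times the
  binomial coefficient of Suc j over i; the alternating sum of these is zero.\<close>

lemma wallis_sum_Suc:
  "real (2 * Suc j + 1) * wallis_sum (Suc j) = real (2 * Suc j) * wallis_sum j"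
proof -
  have "wallis_sum j = (\<Sum>i\<le>Suc j. (-1) ^ i * real (j choose i) / real (2 * i + 1))"
    by (simp add: wallis_sum_def)
  then have "real (2 * Suc j + 1) * wallis_sum (Suc j) - real (2 * Suc j) * wallis_sum j =
    (\<Sum>i\<le>Suc j. real (2 * Suc j + 1) * ((-1) ^ i * real (Suc j choose i) / real (2 * i + 1)) -
      real (2 * Suc j) * ((-1) ^ i * real (j choose i) / real (2 * i + 1)))"
    by (simp only: wallis_sum_def[of "Suc j"] sum_distrib_left sum_subtractf)
  also have "\<dots> = (\<Sum>i\<le>Suc j. (-1) ^ i * real (Suc j choose i))"
  proof (rule sum.cong[OF refl])
    fix i assume "i \<in> {..Suc j}"
    then have "real (Suc j - i) = real (Suc j) - real i" by (simp add: of_nat_diff)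
    moreover have "real (Suc j - i) * real (Suc j choose i) = real (Suc j) * real (j choose i)"
      using binomial_absorb_comp[of "Suc j" i] by (metis diff_Suc_1 of_nat_mult)
    ultimately have *: "real (Suc j) * real (j choose i) = (real (Suc j) - real i) * real (Suc j choose i)"
      by simp
    have "real (2 * Suc j + 1) * ((-1) ^ i * real (Suc j choose i) / real (2 * i + 1)) -
      real (2 * Suc j) * ((-1) ^ i * real (j choose i) / real (2 * i + 1)) =
      (-1) ^ i * ((2 * real (Suc j) + 1) * real (Suc j choose i) - 2 * (real (Suc j) * real (j choose i)))
        / (2 * real i + 1)"
    proof -
      have "real (2 * Suc j + 1) = 2 * real (Suc j) + 1" "real (2 * Suc j) = 2 * real (Suc j)"
        "real (2 * i + 1) = 2 * real i + 1" by simp_all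
      then show ?thesis
        by (simp only: diff_divide_distrib right_diff_distrib)
          (simp only: mult_ac times_divide_eq_right times_divide_eq_left)
    qed
    also have "(2 * real (Suc j) + 1) * real (Suc j choose i) - 2 * (real (Suc j) * real (j choose i)) =
        real (Suc j choose i) * (2 * real i + 1)"
      unfolding * by (simp add: algebra_simps del: of_nat_Suc)
    also have "(-1) ^ i * (real (Suc j choose i) * (2 * real i + 1)) / (2 * real i + 1) =
        (-1) ^ i * real (Suc j choose i)"
      by (simp del: of_nat_Suc)
    finally show "real (2 * Suc j + 1) * ((-1) ^ i * real (Suc j choose i) / real (2 * i + 1)) -
      real (2 * Suc j) * ((-1) ^ i * real (j choose i) / real (2 * i + 1)) =
      (-1) ^ i * real (Suc j choose i)" .
  qed
  also have "\<dots> = 0" by (rule choose_alternating_sum) simp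
  finally show ?thesis by simp
qed

text \<open>The Wallis recurrence multiplies by an even number and divides by an odd one. The gained
  factor 2 feeds the constant term of \<open>quad_moment_recurrence\<close>.\<close>

lemma two_integral_wallis_sum_half:
  assumes "two_integral (wallis_sum j)"
  shows "two_integral (wallis_sum (Suc j) / 2)"
proof -
  have "wallis_sum (Suc j) / 2 = of_int (int (Suc j)) * wallis_sum j / of_int (int (2 * Suc j + 1))"
    using wallis_sum_Suc[of j] by (simp add: field_simps)
  also have "two_integral \<dots>"
    by (intro two_integral_divide two_integral_mult two_integral_of_int assms) simp
  finally show ?thesis .
qed

lemma two_integral_wallis_sum: "two_integral (wallis_sum j)"
proof (induction j)
  case 0
  show ?case using two_integral_of_int[of 1] by (simp add: wallis_sum_def)
next
  case (Suc j)
  then show ?case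
    using two_integral_mult[OF two_integral_of_int[of 2] two_integral_wallis_sum_half] by simp
qed

text \<open>The coefficient of w_l once each even moment in the expansion of 4^j w_j is replaced by
  2 d_(2i+1) / (2i+1) and then expanded.\<close>

definition quad_coeff :: "nat \<Rightarrow> nat \<Rightarrow> real" where
  "quad_coeff j l =
     (\<Sum>i\<le>j. (-1) ^ i * real (j choose i) * of_int (power_sum_coeff (2 * i + 1) l) / real (2 * i + 1))"

lemma two_integral_quad_coeff: "two_integral (quad_coeff j l)"
  unfolding quad_coeff_def
proof (rule two_integral_sum)
  fix i
  have "two_integral (of_int ((-1) ^ i * int (j choose i) * power_sum_coeff (2 * i + 1) l) /
      of_int (int (2 * i + 1)))"
    by (intro two_integral_divide two_integral_of_int) simp
  then show "two_integral ((-1) ^ i * real (j choose i) *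
      of_int (power_sum_coeff (2 * i + 1) l) / real (2 * i + 1))"
    by simp
qed

lemma quad_coeff_eq_0: "j < l \<Longrightarrow> quad_coeff j l = 0"
  unfolding quad_coeff_def by (intro sum.neutral) (simp add: power_sum_coeff_eq_0)

lemma quad_coeff_0: "quad_coeff j 0 = wallis_sum j"
  by (simp add: quad_coeff_def wallis_sum_def power_sum_coeff_0)

text \<open>The diagonal coefficient is exactly 1, so that the coefficient \<open>4 ^ j - 1\<close> of the
  recurrence below is odd.\<close>

lemma quad_coeff_diag: "quad_coeff j j = 1"
proof -
  have "quad_coeff j j =
      (\<Sum>i\<in>{j}. (-1) ^ i * real (j choose i) * of_int (power_sum_coeff (2 * i + 1) j) / real (2 * i + 1))"
    unfolding quad_coeff_def by (rule sum.mono_neutral_right) (auto simp: power_sum_coeff_eq_0)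
  also have "\<dots> = ((-1) ^ j * (-1) ^ j) * ((2 * real j + 1) / (2 * real j + 1))"
    using power_sum_coeff_top(2)[of j] by simp
  finally show ?thesis by (simp flip: power_mult_distrib)
qed

text \<open>After the two sums are interchanged, the term l = 0 is the Wallis sum because w_0 = 1,
  and the diagonal term is moved to the left.\<close>

lemma quad_moment_recurrence:
  "(4 ^ Suc k - 1) * quad_moment (Suc k) =
     wallis_sum (Suc k) + (\<Sum>l<k. quad_coeff (Suc k) (Suc l) * quad_moment (Suc l))"
proof -
  let ?j = "Suc k"
  have moment: "moment (2 * i) =
      (\<Sum>l\<le>2 * ?j + 1. of_int (power_sum_coeff (2 * i + 1) l) * quad_moment l) / real (2 * i + 1)"
    if "i \<le> ?j" for i
    using moment_even_eq_half_moment[of i] two_half_moment_eq_quad_moments[of "2 * i + 1" "2 * ?j + 1"] that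
    by (simp add: field_simps)
  have "4 ^ ?j * quad_moment ?j = (\<Sum>i\<le>?j. \<Sum>l\<le>2 * ?j + 1. (-1) ^ i * real (?j choose i) *
      of_int (power_sum_coeff (2 * i + 1) l) / real (2 * i + 1) * quad_moment l)"
    unfolding quad_moment_eq_moments
  proof (rule sum.cong[OF refl])
    fix i assume "i \<in> {..?j}"
    then show "(-1) ^ i * real (?j choose i) * moment (2 * i) = (\<Sum>l\<le>2 * ?j + 1. (-1) ^ i * real (?j choose i) *
      of_int (power_sum_coeff (2 * i + 1) l) / real (2 * i + 1) * quad_moment l)"
      unfolding moment[of i, OF \<open>i \<in> {..?j}\<close>[unfolded atMost_iff]] sum_divide_distrib sum_distrib_left
      by (intro sum.cong) simp_all
  qed
  also have "\<dots> = (\<Sum>l\<le>2 * ?j + 1. quad_coeff ?j l * quad_moment l)"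
    unfolding quad_coeff_def sum_distrib_right by (rule sum.swap)
  also have "\<dots> = (\<Sum>l\<le>?j. quad_coeff ?j l * quad_moment l)"
    by (rule sum.mono_neutral_right) (auto simp: quad_coeff_eq_0)
  also have "\<dots> = quad_coeff ?j 0 * quad_moment 0 +
      (\<Sum>l<k. quad_coeff ?j (Suc l) * quad_moment (Suc l)) + quad_coeff ?j ?j * quad_moment ?j"
    unfolding sum.atMost_shift sum.lessThan_Suc by simp
  finally show ?thesis
    by (simp add: quad_coeff_0 quad_coeff_diag quad_moment_def expect_1 left_diff_distrib del: power_Suc)
qed

text \<open>Every term on the right of the recurrence carries a factor 2, and the divisor 4^(k+1) -
  1 is odd.\<close>

lemma two_integral_quad_moment: "two_integral (quad_moment (Suc k) / 2)"
proof (induction k rule: less_induct)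
  case (less k)
  have "quad_moment (Suc k) / 2 = (wallis_sum (Suc k) / 2 +
      (\<Sum>l<k. quad_coeff (Suc k) (Suc l) * (quad_moment (Suc l) / 2))) / of_int (4 ^ Suc k - 1)"
  proof -
    have "c \<noteq> 0 \<Longrightarrow> x / 2 = c * x / 2 / c" for c x :: real by simp
    from this[of "4 ^ Suc k - 1" "quad_moment (Suc k)"]
    have "quad_moment (Suc k) / 2 = (4 ^ Suc k - 1) * quad_moment (Suc k) / 2 / (4 ^ Suc k - 1)"
      using one_less_power[of "4::real" "Suc k"] by simp
    then show ?thesis
      unfolding quad_moment_recurrence
      by (simp only: add_divide_distrib sum_divide_distrib times_divide_eq_right
          of_int_diff of_int_power of_int_numeral of_int_1)
  qed
  also have "two_integral \<dots>"
    by (intro two_integral_divide two_integral_add two_integral_sum two_integral_mult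
        two_integral_quad_coeff two_integral_wallis_sum_half two_integral_wallis_sum less.IH) auto
  finally show ?case .
qed

lemma two_half_moment_odd:
  assumes "n \<ge> 1"
  obtains a b :: int where "odd a" "odd b" "2 * half_moment n = of_int a / of_int b"
proof -
  obtain k where n: "n = Suc k" using assms by (cases n) auto
  let ?y = "\<Sum>l\<le>k. of_int (power_sum_coeff n (Suc l)) * (quad_moment (Suc l) / 2)"
  have "2 * half_moment n = 1 + 2 * ?y"
    unfolding two_half_moment_eq_quad_moments[OF order_refl] n sum.atMost_Suc_shift
    by (simp add: power_sum_coeff_0 quad_moment_def expect_1 sum_distrib_left)
  moreover have "two_integral ?y"
    by (intro two_integral_sum two_integral_mult two_integral_of_int two_integral_quad_moment)
  then obtain p q :: int where "odd q" "?y = of_int p / of_int q"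
    unfolding two_integral_def by blast
  moreover from this have "q \<noteq> 0" by auto
  ultimately show ?thesis
    \<comment> \<open>1 + 2p/q = (q + 2p)/q, and q is odd.\<close>
    by (intro that[of "q + 2 * p" q]) (simp_all add: field_simps)
qed

section \<open>The numbers R_n and the valuation\<close>

lemma fact_double_eq: "fact (2 * n) = 2 ^ n * fact n * (\<Prod>i<n. 2 * i + 1 :: nat)"
  by (induction n) (simp_all add: algebra_simps)

text \<open>Splitting (2n)! into 2^n n! and the odd factors cancels n!. The remaining powers of 2
  combine to exponent n - (n - 1) = 1, which is the 2 in front of d_n.\<close>

lemma fabius_R_eq:
  assumes "n \<ge> 1"
  defines "d \<equiv> (\<Prod>i<n. 2 * i + 1) * (\<Prod>m = 1..n div 2. 4 ^ m - 1)"
  shows "fabius_R n = real d * (2 * half_moment n)"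
proof -
  obtain m where n: "n = Suc m" using assms by (cases n) auto
  have P: "(\<Prod>m = 1..n div 2. 2 ^ (2 * m) - 1) = real (\<Prod>m = 1..n div 2. 4 ^ m - 1)"
    by (simp add: of_nat_diff power_mult)
  have c: "n choose 2 = m + (m choose 2)" by (simp add: n numeral_2_eq_2)
  have f: "fact (2 * n) = 2 ^ n * fact n * real (\<Prod>i<n. 2 * i + 1)"
    using arg_cong[OF fact_double_eq[of n], of real] by (simp del: of_nat_prod)
  show ?thesis
    unfolding fabius_R_def fabius_dyadic[OF assms(1)] rvachev_up_dyadic P f c d_def of_nat_mult
    by (simp add: n power_add field_simps del: of_nat_prod fact_Suc prod.lessThan_Suc)
qed

text \<open>The moment recurrence shows that only a power of 2 can remain in the denominator of R_n;
  the parity argument then excludes it.\<close>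

lemma fabius_R_mult_power:
  assumes "n \<ge> 1"
  shows "2 ^ (n - 1) * fabius_R n \<in> \<nat>"
proof -
  let ?k = "n div 2"
  let ?d = "(\<Prod>i<n. 2 * i + 1) * (\<Prod>m = 1..?k. 4 ^ m - 1) :: nat"
  have "(\<Prod>m = 1..?k. 2 * m + 1) dvd (\<Prod>i<n. 2 * i + 1 :: nat)"
    by (rule prod_dvd_prod_subset) (use assms in auto)
  then have "moment_denominator ?k dvd ?d"
    unfolding moment_denominator_def prod.distrib by (rule mult_dvd_mono) simp
  then obtain c where c: "?d = moment_denominator ?k * c" by (rule dvdE)
  have "2 ^ (n - 1) * fabius_R n = real ?d * (2 ^ n * half_moment n)"
    unfolding fabius_R_eq[OF assms]
    using power_minus_mult[of n "2::real"] assms by (simp del: of_nat_prod of_nat_mult add: mult_ac)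
  also have "\<dots> = (\<Sum>i\<le>n. real c * real (n choose i) * (real (moment_denominator ?k) * moment i))"
    unfolding half_moment_eq_sum_moments c sum_distrib_left by (intro sum.cong) simp_all
  also have "\<dots> \<in> \<nat>"
    by (intro sum_in_Nats Nats_mult of_nat_in_Nats moment_denominator_mult_moment) auto
  finally show ?thesis .
qed

text \<open>A denominator that is both odd and a divisor of a power of 2 must be trivial.\<close>

lemma odd_natural_of_odd_fraction:
  fixes x :: real and a b :: int
  assumes "odd a" "odd b" "x = of_int a / of_int b" "2 ^ m * x \<in> \<nat>"
  shows "\<exists>N. x = real N \<and> odd N"
proof -
  obtain K where K: "2 ^ m * x = real K" using assms(4) by (auto simp: Nats_def)
  have b: "b \<noteq> 0" using assms(2) by auto
  have "of_int (2 ^ m * a) = (of_int (int K * b) :: real)"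
    using K b assms(3) by (simp add: field_simps)
  then have eq: "2 ^ m * a = int K * b" by (simp only: of_int_eq_iff)
  have "coprime (2 ^ m) b" using assms(2) by simp
  moreover have "2 ^ m dvd int K * b" unfolding eq[symmetric] by simp
  ultimately have "2 ^ m dvd int K" by (simp add: coprime_dvd_mult_left_iff)
  then obtain M where M: "int K = 2 ^ m * M" by (rule dvdE)
  then have "M \<ge> 0" by (metis of_nat_0_le_iff zero_le_mult_iff not_le zero_less_numeral zero_less_power)
  have "a = M * b" using eq M by simp
  then have "odd M" and x: "x = of_int M" using assms(1,3) b by auto
  then show ?thesis
    using \<open>M \<ge> 0\<close> by (intro exI[of _ "nat M"]) (simp add: even_nat_iff)
qed

text \<open>Cross-multiplying with the reduced fraction shows that the valuation can be read off any
  representation.\<close>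

lemma dyadic_valuation_of_int_divide:
  assumes "a \<noteq> 0" "b \<noteq> 0"
  shows "dyadic_valuation (of_int a / of_int b) = int (multiplicity 2 a) - int (multiplicity 2 b)"
proof -
  obtain p q where pq: "quotient_of (of_int a / of_int b) = (p, q)" by fastforce
  have q: "q > 0" using quotient_of_denom_pos[OF pq] .
  have "of_int a / of_int b = (of_int p / of_int q :: rat)" by (rule quotient_of_div[OF pq])
  then have "of_int (a * q) = (of_int (p * b) :: rat)"
    using assms q by (simp add: field_simps)
  then have eq: "a * q = p * b" by (simp only: of_int_eq_iff)
  then have "p \<noteq> 0" using assms q by auto
  then have "multiplicity 2 a + multiplicity 2 q = multiplicity 2 p + multiplicity 2 b"
    using arg_cong[OF eq, of "multiplicity 2"] assms q by (simp add: prime_elem_multiplicity_mult_distrib)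
  then show ?thesis unfolding dyadic_valuation_def pq by simp
qed

theorem theorem21:
  fixes n :: nat
  assumes "n \<ge> 1"
  shows "(\<exists>N :: nat. fabius_R n = real N \<and> odd N) \<and>
         (\<exists>r :: rat. rvachev_up (1 - 1 / 2 ^ n) = of_rat r \<and> r \<noteq> 0 \<and>
            dyadic_valuation r = - int (n choose 2) - 1 - dyadic_valuation (fact n))"
proof
  obtain a b :: int where ab: "odd a" "odd b" "2 * half_moment n = of_int a / of_int b"
    using two_half_moment_odd[OF assms] .
  let ?d = "(\<Prod>i<n. 2 * i + 1) * (\<Prod>m = 1..n div 2. 4 ^ m - 1) :: nat"
  have "odd (4 ^ m - 1 :: nat)" if "m \<ge> 1" for m using that by simp
  then have "odd ?d" by (simp add: even_prod_iff)
  have "fabius_R n = of_int (int ?d * a) / of_int b"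
    unfolding fabius_R_eq[OF assms] ab(3) by simp
  moreover have "odd (int ?d * a)" using \<open>odd ?d\<close> ab(1) by (simp only: even_mult_iff even_of_nat) simp
  ultimately show "\<exists>N :: nat. fabius_R n = real N \<and> odd N"
    using odd_natural_of_odd_fraction ab(2) fabius_R_mult_power[OF assms] by blast
  \<comment> \<open>Since d_n = a / (2b), the exponent of 2 exceeds the binomial coefficient by one;
    this is the -1 in the valuation.\<close>
  let ?B = "b * (2 ^ Suc (n choose 2) * fact n)"
  let ?r = "of_int a / of_int ?B :: rat"
  have ab0: "a \<noteq> 0" "b \<noteq> 0" using ab by auto
  have "rvachev_up (1 - 1 / 2 ^ n) = of_rat ?r"
  proof -
    have "real_of_rat (fact n) = fact n" by (metis of_nat_fact of_rat_of_nat_eq)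
    then show ?thesis
      unfolding rvachev_up_dyadic using ab(3) ab0
      by (simp add: of_rat_divide of_rat_mult of_rat_power field_simps)
  qed
  moreover have "?r \<noteq> 0" using ab0 by simp
  moreover have "dyadic_valuation ?r = - int (n choose 2) - 1 - dyadic_valuation (fact n)"
  proof -
    have "multiplicity 2 ?B = Suc (n choose 2) + multiplicity 2 (fact n :: int)"
      using ab0 ab(2) by (simp add: prime_elem_multiplicity_mult_distrib not_dvd_imp_multiplicity_0
          multiplicity_same_power del: power_Suc)
    moreover have "dyadic_valuation (fact n) = int (multiplicity 2 (fact n :: int))"
      using dyadic_valuation_of_int_divide[of "fact n" 1] by simp
    moreover have "multiplicity 2 a = 0" using ab(1) by (simp add: not_dvd_imp_multiplicity_0)
    ultimately show ?thesis
      using ab0 by (subst dyadic_valuation_of_int_divide) auto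
  qed
  ultimately show "\<exists>r :: rat. rvachev_up (1 - 1 / 2 ^ n) = of_rat r \<and> r \<noteq> 0 \<and>
            dyadic_valuation r = - int (n choose 2) - 1 - dyadic_valuation (fact n)"
    by blast
qed

end
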